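(* Let $\alpha,\beta>-1$, $M,N>0$, and let $j$ be a non-negative integer. Then $$\lim_{n\to+\infty}\frac{(Q_n^{M,N})^{(j)}(-1)}{(\tilde P_n^{(\alpha,\beta)})^{(j)}(-1)}=\frac{j(j-1)}{(\beta+j+1)(\beta+j+2)}.$$
   Context: Let $d\mu(x)=(1-x)^\alpha(1+x)^\beta\,dx$ on $(-1,1)$ and let $P_n^{(\alpha,\beta)}$ be the monic Jacobi polynomials, orthogonal with respect to $\mu$. Set $$\tilde P_n^{(\alpha,\beta)}(x)=\frac{(n+\alpha+\beta+1)_n}{2^n(\alpha+1)_n}P_n^{(\alpha,\beta)}(x),$$ where $(y)_n=y(y+1)\cdots(y+n-1)$ is the Pochhammer symbol (equivalently, $\tilde P_n^{(\alpha,\beta)}(1)=1$). The polynomials $Q_n^{M,N}$, $\deg Q_n^{M,N}=n$, are orthogonal with respect to the Sobolev inner product $$\langle p,q\rangle_S=\int_{-1}^1p(x)q(x)\,d\mu(x)+Mp(-1)q(-1)+Np'(-1)q'(-1),$$ normalized so that $Q_n^{M,N}$ has the same leading coefficient as $\tilde P_n^{(\alpha,\beta)}$. The superscript $(j)$ denotes the $j$-th derivative. *)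

theory Defs
  imports "HOL-Analysis.Analysis" "HOL-Computational_Algebra.Polynomial"
begin

definition jacobi_measure :: "real \<Rightarrow> real \<Rightarrow> real measure" where
  "jacobi_measure \<alpha> \<beta> =
     density lborel
       (\<lambda>x. ennreal ((1 - x) powr \<alpha> * (1 + x) powr \<beta>) * indicator {-1<..<1} x)"

definition jacobi_inner :: "real \<Rightarrow> real \<Rightarrow> real poly \<Rightarrow> real poly \<Rightarrow> real" where
  "jacobi_inner \<alpha> \<beta> p q = (\<integral>x. poly p x * poly q x \<partial>jacobi_measure \<alpha> \<beta>)"

definition sobolev_inner ::
  "real \<Rightarrow> real \<Rightarrow> real \<Rightarrow> real \<Rightarrow> real poly \<Rightarrow> real poly \<Rightarrow> real" where
  "sobolev_inner \<alpha> \<beta> M N p q =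
     jacobi_inner \<alpha> \<beta> p q
       + M * poly p (-1) * poly q (-1)
       + N * poly (pderiv p) (-1) * poly (pderiv q) (-1)"

text \<open>The condition \<open>p n \<noteq> 0\<close> matters only for \<open>n = 0\<close>, since the zero polynomial
  has degree \<open>0\<close>.\<close>

definition orthogonal_poly_seq ::
  "(real poly \<Rightarrow> real poly \<Rightarrow> real) \<Rightarrow> (nat \<Rightarrow> real poly) \<Rightarrow> bool" where
  "orthogonal_poly_seq ip p \<longleftrightarrow>
     (\<forall>n. p n \<noteq> 0 \<and> degree (p n) = n) \<and>
     (\<forall>m n. m \<noteq> n \<longrightarrow> ip (p m) (p n) = 0)"

definition monic_jacobi_seq :: "real \<Rightarrow> real \<Rightarrow> (nat \<Rightarrow> real poly) \<Rightarrow> bool" where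
  "monic_jacobi_seq \<alpha> \<beta> P \<longleftrightarrow>
     orthogonal_poly_seq (jacobi_inner \<alpha> \<beta>) P \<and> (\<forall>n. lead_coeff (P n) = 1)"

text \<open>For the monic Jacobi polynomials \<open>P\<close> the scaling factor is the one giving
  the value \<open>1\<close> at \<open>x = 1\<close>.\<close>

definition jacobi_tilde ::
  "real \<Rightarrow> real \<Rightarrow> (nat \<Rightarrow> real poly) \<Rightarrow> nat \<Rightarrow> real poly" where
  "jacobi_tilde \<alpha> \<beta> P n =
     smult (pochhammer (real n + \<alpha> + \<beta> + 1) n / (2 ^ n * pochhammer (\<alpha> + 1) n)) (P n)"

definition jacobi_sobolev_seq ::
  "real \<Rightarrow> real \<Rightarrow> real \<Rightarrow> real \<Rightarrow> (nat \<Rightarrow> real poly) \<Rightarrow> (nat \<Rightarrow> real poly) \<Rightarrow> bool" where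
  "jacobi_sobolev_seq \<alpha> \<beta> M N P Q \<longleftrightarrow>
     orthogonal_poly_seq (sobolev_inner \<alpha> \<beta> M N) Q \<and>
     (\<forall>n. lead_coeff (Q n) = lead_coeff (jacobi_tilde \<alpha> \<beta> P n))"

end

theory Submission
  imports Defs
begin

text \<open>
  Both families have a common hypergeometric description at the endpoint \<open>-1\<close>. Let
  \<open>R n = F(-n, n + \<alpha> + \<beta> + 1; \<beta> + 1; (1 + x) / 2)\<close>, the Jacobi polynomial scaled to
  take the value \<open>1\<close> at \<open>-1\<close>. Its orthogonality and its norm follow from the Beta
  integral and the Chu-Vandermonde identity (lemma \<open>jint_R_mult_power\<close>), and its
  derivatives at \<open>-1\<close> can be read off from its coefficients.

  The Sobolev product differs from the Jacobi product only by two point functionals at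
  \<open>-1\<close>. Expanding \<open>Q n\<close> in the basis \<open>R k\<close>, its coefficient at each \<open>k < n\<close> is therefore
  fixed by the two numbers \<open>Q n (-1)\<close> and \<open>(Q n)' (-1)\<close> (lemma \<open>sobolev_expansion\<close>).
  After division by the leading coefficient, the derivatives \<open>y i n\<close> of \<open>Q n\<close> and
  \<open>r i n\<close> of \<open>R n\<close> at \<open>-1\<close> satisfy, with \<open>S k\<close> the inverse squared norm of \<open>R k\<close>,
  \<open>y i n = r i n - M * y 0 n * K 0 i n - N * y 1 n * K 1 i n\<close>, where
  \<open>K i j n = (\<Sum>k<n. r i k * r j k * S k)\<close>. For \<open>i = 0\<close> and \<open>i = 1\<close> this is a linear
  system that determines \<open>y 0 n\<close> and \<open>y 1 n\<close>; the other equations then give every \<open>y j n\<close>.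

  The summands \<open>r i k * r j k * S k\<close> behave like a power of \<open>k\<close> with exponent
  \<open>2\<beta> + 1 + 2i + 2j\<close>. The constant of this power law cancels in the end, so the only
  information used is that consecutive summands have a ratio \<open>1 + \<rho> / n + o(1 / n)\<close> with
  this exponent \<open>\<rho>\<close>: then the partial sum divided by \<open>n\<close> times the next summand tends to \<open>1 / (\<rho> + 1)\<close> by the Stolz-Cesaro
  theorem (lemma \<open>partial_sum_over_next_term\<close>). In normalized form the kernels thus converge to
  the Cauchy-type values \<open>1 / (2 * (b + i + j))\<close> with \<open>b = \<beta> + 1\<close>, while \<open>M\<close> and \<open>N\<close>
  disappear from the limiting system since the kernels are unbounded. The limit of the
  quotient as a function of \<open>j\<close> is of the form \<open>1 - A / (b + j) - B / (b + j + 1)\<close>; it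
  vanishes at \<open>j = 0\<close> and \<open>j = 1\<close>, so it is
  \<open>j * (j - 1) / ((b + j) * (b + j + 1))\<close> (lemma \<open>rank_two_perturbation_limit\<close>).
\<close>

section \<open>Sequences whose consecutive quotients are known to first order\<close>

text \<open>
  The expansion \<open>x n = 1 + a / n + o(1 / n)\<close>. When \<open>x\<close> is the quotient of consecutive
  terms of a sequence, it plays the part of growth like \<open>n powr a\<close>.
\<close>

definition first_order :: "(nat \<Rightarrow> real) \<Rightarrow> real \<Rightarrow> bool" where
  "first_order x a \<longleftrightarrow> (\<lambda>n. real n * (x n - 1)) \<longlonglongrightarrow> a"

lemma first_order_imp_tendsto_1:
  assumes "first_order x a"
  shows "x \<longlonglongrightarrow> 1"
proof -
  have "(\<lambda>n. real n * (x n - 1) * (1 / real n) + 1) \<longlonglongrightarrow> a * 0 + 1"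
    using assms unfolding first_order_def by (intro tendsto_intros lim_1_over_n)
  moreover have "\<forall>\<^sub>F n in sequentially. real n * (x n - 1) * (1 / real n) + 1 = x n"
    using eventually_gt_at_top[of 0] by eventually_elim auto
  ultimately show ?thesis by (auto intro: Lim_transform_eventually)
qed

lemma first_order_mult:
  assumes "first_order x a" and "first_order y b"
  shows "first_order (\<lambda>n. x n * y n) (a + b)"
proof -
  have "(\<lambda>n. real n * (x n - 1) * y n + real n * (y n - 1)) \<longlonglongrightarrow> a * 1 + b"
    using assms first_order_imp_tendsto_1[OF assms(2)]
    unfolding first_order_def by (intro tendsto_intros)
  then show ?thesis by (simp add: first_order_def algebra_simps)
qed

lemma first_order_linear_quotient:
  "first_order (\<lambda>n. (real n + c) / (real n + d)) (c - d)"
proof -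
  have "(\<lambda>n. (c - d) * (1 - d * inverse (d + real n))) \<longlonglongrightarrow> (c - d) * (1 - d * 0)"
    by (intro tendsto_intros tendsto_inverse_0_at_top
        filterlim_tendsto_add_at_top[OF tendsto_const filterlim_real_sequentially])
  moreover have "\<forall>\<^sub>F n in sequentially. (c - d) * (1 - d * inverse (d + real n))
      = real n * ((real n + c) / (real n + d) - 1)"
    using eventually_gt_at_top[of "nat \<lceil>\<bar>d\<bar>\<rceil>"]
  proof eventually_elim
    case (elim n)
    then have "real n + d \<noteq> 0" "d + real n \<noteq> 0" by linarith+
    then show ?case by (simp add: divide_simps)
  qed
  ultimately show ?thesis unfolding first_order_def by (auto intro: Lim_transform_eventually)
qed

lemma first_order_cong:
  assumes "\<forall>\<^sub>F n in sequentially. x n = y n"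
  shows "first_order x a \<longleftrightarrow> first_order y a"
  unfolding first_order_def by (rule tendsto_cong) (use assms in eventually_elim, simp)

text \<open>
  Once the quotient of increments is within \<open>e / 2\<close> of \<open>L\<close>, summing the increments keeps
  \<open>a - L * b\<close> within \<open>e / 2\<close> times the growth of \<open>b\<close>, and the starting values are
  absorbed because \<open>b\<close> is unbounded.
\<close>

lemma stolz_cesaro:
  fixes a b :: "nat \<Rightarrow> real"
  assumes inc: "\<forall>\<^sub>F n in sequentially. b n < b (Suc n)"
    and b: "filterlim b at_top sequentially"
    and lim: "(\<lambda>n. (a (Suc n) - a n) / (b (Suc n) - b n)) \<longlonglongrightarrow> L"
  shows "(\<lambda>n. a n / b n) \<longlonglongrightarrow> L"
proof (rule tendstoI)
  fix e :: real
  assume e: "e > 0"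
  have "\<forall>\<^sub>F n in sequentially. \<bar>(a (Suc n) - a n) - L * (b (Suc n) - b n)\<bar>
      \<le> e / 2 * (b (Suc n) - b n)"
    using inc tendstoD[OF lim half_gt_zero[OF e]]
  proof eventually_elim
    case (elim n)
    then show ?case
      by (simp add: dist_real_def abs_le_iff abs_less_iff field_simps)
  qed
  then obtain N where N: "\<And>n. n \<ge> N \<Longrightarrow> \<bar>(a (Suc n) - a n) - L * (b (Suc n) - b n)\<bar>
      \<le> e / 2 * (b (Suc n) - b n)"
    by (auto simp: eventually_sequentially)
  have telescoped: "\<bar>(a n - a N) - L * (b n - b N)\<bar> \<le> e / 2 * (b n - b N)" if "n \<ge> N" for n
    using that
  proof (induction n rule: dec_induct)
    case (step n)
    have "(a (Suc n) - a N) - L * (b (Suc n) - b N)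
        = ((a n - a N) - L * (b n - b N)) + ((a (Suc n) - a n) - L * (b (Suc n) - b n))"
      "e / 2 * (b (Suc n) - b N) = e / 2 * (b n - b N) + e / 2 * (b (Suc n) - b n)"
      by (simp_all add: field_simps)
    with step N[of n] show ?case by linarith
  qed simp
  define D where "D = \<bar>a N - L * b N\<bar> + e / 2 * \<bar>b N\<bar>"
  have "\<forall>\<^sub>F n in sequentially. b n > 2 * D / e + 1"
    using b by (auto simp: filterlim_at_top_dense)
  then show "\<forall>\<^sub>F n in sequentially. dist (a n / b n) L < e"
    using eventually_ge_at_top[of N]
  proof eventually_elim
    case (elim n)
    have "2 * D / e \<ge> 0" using e by (simp add: D_def)
    with elim have pos: "b n > 0" by linarith
    have "D < e / 2 * b n" using elim(1) e by (simp add: field_simps)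
    moreover have "\<bar>a n - L * b n\<bar> \<le> e / 2 * b n + D"
    proof -
      have "- (e / 2 * b N) \<le> e / 2 * \<bar>b N\<bar>"
        using mult_left_mono[of "- b N" "\<bar>b N\<bar>" "e / 2"] e by simp
      moreover have "L * (b n - b N) = L * b n - L * b N" "e / 2 * (b n - b N) = e / 2 * b n - e / 2 * b N"
        by (simp_all add: right_diff_distrib)
      ultimately show ?thesis
        using telescoped[OF elim(2)] unfolding D_def by linarith
    qed
    ultimately have "\<bar>a n - L * b n\<bar> < e * b n" by linarith
    then show ?case using pos by (simp add: dist_real_def abs_less_iff field_simps)
  qed
qed

text \<open>
  Since \<open>ln (1 + 1 / n) \<le> 1 / n\<close>, the sequence \<open>W n - c * ln n\<close> is eventually increasing.
\<close>

lemma at_top_if_increments_ge_harmonic: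
  fixes W :: "nat \<Rightarrow> real"
  assumes c: "c > 0" and inc: "\<forall>\<^sub>F n in sequentially. W (Suc n) - W n \<ge> c / real n"
  shows "filterlim W at_top sequentially"
proof -
  from eventually_conj[OF inc eventually_gt_at_top[of 0]]
  obtain N where N: "\<And>n. n \<ge> N \<Longrightarrow> W (Suc n) - W n \<ge> c / real n" "\<And>n. n \<ge> N \<Longrightarrow> n > 0"
    by (auto simp: eventually_sequentially)
  have ge: "W n \<ge> (W N - c * ln (real N)) + c * ln (real n)" if "n \<ge> N" for n
    using that
  proof (induction n rule: dec_induct)
    case (step n)
    have n: "n > 0" using N(2) step by simp
    have "ln (real (Suc n)) - ln (real n) = ln (real (Suc n) / real n)"
      using n by (simp add: ln_div)
    also have "real (Suc n) / real n = 1 + 1 / real n"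
      using n by (simp add: field_simps)
    also have "ln \<dots> \<le> 1 / real n" by (rule ln_add_one_self_le_self) simp
    finally have "c * ln (real (Suc n)) - c * ln (real n) \<le> c / real n"
      using c mult_left_mono[of _ _ c] by (fastforce simp: right_diff_distrib)
    with N(1)[of n] step show ?case by simp
  qed simp
  have "filterlim (\<lambda>n. (W N - c * ln (real N)) + c * ln (real n)) at_top sequentially"
    by (intro filterlim_tendsto_add_at_top[OF tendsto_const]
        filterlim_tendsto_pos_mult_at_top[OF tendsto_const c]
        filterlim_compose[OF ln_at_top filterlim_real_sequentially])
  then show ?thesis
    by (rule filterlim_at_top_mono) (use ge in \<open>auto simp: eventually_sequentially\<close>)
qed

text \<open>
  With \<open>W n = n * T n\<close> the increment of \<open>W\<close> is \<open>T n * (\<rho> + 1 + o(1))\<close>, whereas that of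
  the partial sum is \<open>T n\<close>; this is the Stolz-Cesaro situation. For the divergence of \<open>W\<close>,
  its increments are at least a positive multiple of \<open>T n = W n / n\<close>, and \<open>W\<close> increases.
\<close>

lemma partial_sum_over_next_term_pos:
  fixes T :: "nat \<Rightarrow> real"
  assumes ratio: "first_order (\<lambda>n. T (Suc n) / T n) \<rho>" and \<rho>: "\<rho> > -1"
    and pos: "\<forall>\<^sub>F n in sequentially. T n > 0"
  shows "filterlim (\<lambda>n. real n * T n) at_top sequentially"
    and "(\<lambda>n. (\<Sum>k<n. T k) / (real n * T n)) \<longlonglongrightarrow> 1 / (\<rho> + 1)"
proof -
  define W where "W n = real n * T n" for n
  define x where "x n = T (Suc n) / T n" for n
  \<comment> \<open>The bracket is the increment of \<open>W\<close> divided by \<open>T n\<close>.\<close>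
  have d: "(\<lambda>n. real n * (x n - 1) + x n) \<longlonglongrightarrow> \<rho> + 1"
    using ratio first_order_imp_tendsto_1[OF ratio] unfolding first_order_def x_def
    by (intro tendsto_intros)
  have incr: "\<forall>\<^sub>F n in sequentially. W (Suc n) - W n = T n * (real n * (x n - 1) + x n)"
    using pos by eventually_elim (simp add: W_def x_def field_simps)
  have half: "\<forall>\<^sub>F n in sequentially. real n * (x n - 1) + x n > (\<rho> + 1) / 2"
    using d \<rho> by (intro order_tendstoD) auto
  have inc': "\<forall>\<^sub>F n in sequentially. W (Suc n) - W n \<ge> (\<rho> + 1) / 2 * T n \<and> T n > 0"
    using pos incr half
    by eventually_elim (simp add: mult.commute)
  have inc: "\<forall>\<^sub>F n in sequentially. W n < W (Suc n)"
    using inc'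
  proof eventually_elim
    case (elim n)
    have "(\<rho> + 1) / 2 * T n > 0" using elim \<rho> by simp
    with elim show ?case by linarith
  qed
  from eventually_conj[OF eventually_conj[OF inc pos] eventually_gt_at_top[of 0]]
  obtain N where N: "\<And>n. n \<ge> N \<Longrightarrow> W n < W (Suc n)" "T N > 0" "N > 0"
    by (auto simp: eventually_sequentially)
  have mono: "W n \<ge> W N" if "n \<ge> N" for n
    using that by (induction n rule: dec_induct) (use N(1) in fastforce)+
  have WN: "W N > 0" using N by (simp add: W_def)
  show top: "filterlim (\<lambda>n. real n * T n) at_top sequentially"
    unfolding W_def[symmetric]
  proof (rule at_top_if_increments_ge_harmonic)
    show "(\<rho> + 1) / 2 * W N > 0" using WN \<rho> by simp
    show "\<forall>\<^sub>F n in sequentially. W (Suc n) - W n \<ge> (\<rho> + 1) / 2 * W N / real n"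
      using inc' eventually_ge_at_top[of N]
    proof eventually_elim
      case (elim n)
      then have "W N / real n \<le> T n"
        using mono[of n] N by (simp add: W_def field_simps)
      then have "(\<rho> + 1) / 2 * (W N / real n) \<le> (\<rho> + 1) / 2 * T n"
        using \<rho> by (intro mult_left_mono) auto
      with elim show ?case by simp
    qed
  qed
  show "(\<lambda>n. (\<Sum>k<n. T k) / (real n * T n)) \<longlonglongrightarrow> 1 / (\<rho> + 1)"
    unfolding W_def[symmetric]
  proof (rule stolz_cesaro[OF inc])
    show "filterlim W at_top sequentially" using top by (simp add: W_def[abs_def])
    have "(\<lambda>n. 1 / (real n * (x n - 1) + x n)) \<longlonglongrightarrow> 1 / (\<rho> + 1)"
      by (rule tendsto_divide[OF tendsto_const d]) (use \<rho> in simp)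
    moreover have "\<forall>\<^sub>F n in sequentially. 1 / (real n * (x n - 1) + x n)
        = ((\<Sum>k<Suc n. T k) - (\<Sum>k<n. T k)) / (W (Suc n) - W n)"
      using incr pos by eventually_elim simp
    ultimately show "(\<lambda>n. ((\<Sum>k<Suc n. T k) - (\<Sum>k<n. T k)) / (W (Suc n) - W n)) \<longlonglongrightarrow> 1 / (\<rho> + 1)"
      by (rule Lim_transform_eventually)
  qed
qed

text \<open>
  The quotients tend to \<open>1\<close>, so the terms have constant sign from some index \<open>N\<close> on;
  dividing by \<open>T N\<close> reduces the claim to positive terms.
\<close>

lemma partial_sum_over_next_term:
  fixes T :: "nat \<Rightarrow> real"
  assumes ratio: "first_order (\<lambda>n. T (Suc n) / T n) \<rho>" and \<rho>: "\<rho> > -1"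
  shows "(\<lambda>n. 1 / (real n * T n)) \<longlonglongrightarrow> 0"
    and "(\<lambda>n. (\<Sum>k<n. T k) / (real n * T n)) \<longlonglongrightarrow> 1 / (\<rho> + 1)"
proof -
  have "\<forall>\<^sub>F n in sequentially. T (Suc n) / T n > 0"
    using first_order_imp_tendsto_1[OF ratio] by (intro order_tendstoD) auto
  then obtain N where N: "\<And>n. n \<ge> N \<Longrightarrow> T (Suc n) / T n > 0"
    by (auto simp: eventually_sequentially)
  define t where "t n = T n / T N" for n
  have TN: "T N \<noteq> 0" using N[of N] by auto
  have tpos: "t n > 0" if "n \<ge> N" for n
    using that
  proof (induction n rule: dec_induct)
    case (step n)
    then have "t n * (T (Suc n) / T n) > 0" using N by (intro mult_pos_pos) auto
    moreover have "T n \<noteq> 0" using step by (auto simp: t_def)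
    ultimately show ?case by (simp add: t_def)
  qed (use TN in \<open>simp add: t_def\<close>)
  have "first_order (\<lambda>n. t (Suc n) / t n) \<rho>" using ratio TN by (simp add: t_def)
  note aux = partial_sum_over_next_term_pos[OF this \<rho>]
  have pos: "\<forall>\<^sub>F n in sequentially. t n > 0"
    using tpos by (auto simp: eventually_sequentially)
  have "(\<lambda>n. inverse (real n * t n) * (1 / T N)) \<longlonglongrightarrow> 0 * (1 / T N)"
    by (intro tendsto_intros tendsto_inverse_0_at_top aux(1) pos)
  then show "(\<lambda>n. 1 / (real n * T n)) \<longlonglongrightarrow> 0"
    using TN by (simp add: t_def field_simps)
  show "(\<lambda>n. (\<Sum>k<n. T k) / (real n * T n)) \<longlonglongrightarrow> 1 / (\<rho> + 1)"
    using aux(2)[OF pos] TN by (simp add: t_def sum_divide_distrib[symmetric])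
qed

section \<open>The limit of a rank-two kernel perturbation\<close>

text \<open>
  Divide the equation for \<open>y i\<close> by \<open>r i\<close> and write \<open>\<kappa> i j\<close> for the normalized kernels.
  The unknowns \<open>A\<close> and \<open>B\<close> are the normalized multiples of \<open>y 0\<close> and \<open>y 1\<close>. In terms of
  these, the left-hand sides \<open>y 0 / r 0\<close> and \<open>y 1 / r 1\<close> become \<open>\<epsilon> * A\<close> and \<open>\<delta> * B\<close>
  with \<open>\<epsilon>\<close> and \<open>\<delta>\<close> tending to \<open>0\<close>, so Cramer's rule gives the limits of \<open>A\<close> and \<open>B\<close>.
\<close>

lemma rank_two_perturbation_limit:
  fixes r :: "nat \<Rightarrow> nat \<Rightarrow> real" and S :: "nat \<Rightarrow> real" and y :: "nat \<Rightarrow> nat \<Rightarrow> real"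
    and b M N :: real
  defines "K \<equiv> \<lambda>i j n. \<Sum>k<n. r i k * r j k * S k"
  assumes b: "b > 0" and MN: "M > 0" "N > 0"
    and growth: "\<And>i j. first_order (\<lambda>n. (r i (Suc n) * r j (Suc n) * S (Suc n)) / (r i n * r j n * S n))
                    (2 * b + 2 * real i + 2 * real j - 1)"
    and system: "\<And>n i. y i n = r i n - M * y 0 n * K 0 i n - N * y 1 n * K 1 i n"
  shows "(\<lambda>n. y j n / r j n) \<longlonglongrightarrow> real j * (real j - 1) / ((b + real j) * (b + real j + 1))"
proof -
  define T where "T i j n = r i n * r j n * S n" for i j n
  define \<kappa> where "\<kappa> i j n = K i j n / (real n * T i j n)" for i j n
  have pos: "2 * b + 2 * real i + 2 * real j - 1 > -1" for i j using b by simp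
  have ratio: "first_order (\<lambda>n. T i j (Suc n) / T i j n) (2 * b + 2 * real i + 2 * real j - 1)" for i j
    using growth by (simp add: T_def)
  have \<kappa>: "\<kappa> i j \<longlonglongrightarrow> 1 / (2 * (b + real i + real j))" for i j
    using partial_sum_over_next_term(2)[OF ratio pos, of i j] by (simp add: \<kappa>_def[abs_def] K_def T_def algebra_simps)
  have small: "(\<lambda>n. 1 / (real n * T i i n)) \<longlonglongrightarrow> 0" for i
    by (rule partial_sum_over_next_term(1)[OF ratio pos])
  have nz: "\<forall>\<^sub>F n in sequentially. r i n \<noteq> 0 \<and> S n \<noteq> 0" for i
  proof -
    have "\<forall>\<^sub>F n in sequentially. T i i (Suc n) / T i i n > 0"
      using first_order_imp_tendsto_1[OF ratio] by (intro order_tendstoD) auto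
    then show ?thesis by eventually_elim (auto simp: T_def)
  qed
  define \<epsilon> \<delta> where "\<epsilon> n = 1 / (real n * T 0 0 n) / M" and "\<delta> n = 1 / (real n * T 1 1 n) / N" for n
  have \<epsilon>: "\<epsilon> \<longlonglongrightarrow> 0" and \<delta>: "\<delta> \<longlonglongrightarrow> 0"
    using tendsto_divide[OF small tendsto_const] MN by (force simp: \<epsilon>_def[abs_def] \<delta>_def[abs_def])+
  define A B where "A n = M * real n * S n * r 0 n * y 0 n" and "B n = N * real n * S n * r 1 n * y 1 n" for n
  have z: "\<forall>\<^sub>F n in sequentially. y i n / r i n = 1 - A n * \<kappa> 0 i n - B n * \<kappa> 1 i n" for i
    using nz[of i] nz[of 0] nz[of 1] eventually_gt_at_top[of 0]
  proof eventually_elim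
    case (elim n)
    have "A n * \<kappa> 0 i n = M * y 0 n * K 0 i n / r i n" "B n * \<kappa> 1 i n = N * y 1 n * K 1 i n / r i n"
      using elim by (simp_all add: A_def B_def \<kappa>_def T_def)
    then show ?case using elim system[of i n] by (simp add: diff_divide_distrib)
  qed
  define D where "D n = (\<kappa> 0 0 n + \<epsilon> n) * (\<kappa> 1 1 n + \<delta> n) - \<kappa> 0 1 n * \<kappa> 0 1 n" for n
  define \<kappa>' where "\<kappa>' i = 1 / (2 * (b + i))" for i :: real
  define D' where "D' = \<kappa>' 0 * \<kappa>' 2 - \<kappa>' 1 * \<kappa>' 1"
  \<comment> \<open>This Cauchy determinant does not vanish, so Cramer's rule survives in the limit.\<close>
  have D'_eq: "D' = 1 / (4 * b * (b + 1)\<^sup>2 * (b + 2))"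
    using b by (simp add: D'_def \<kappa>'_def divide_simps) algebra
  have D'0: "D' \<noteq> 0" using b by (simp add: D'_eq)
  have \<kappa>01: "\<kappa> 0 0 \<longlonglongrightarrow> \<kappa>' 0" "\<kappa> 0 1 \<longlonglongrightarrow> \<kappa>' 1" "\<kappa> 1 1 \<longlonglongrightarrow> \<kappa>' 2"
    using \<kappa>[of 0 0] \<kappa>[of 0 1] \<kappa>[of 1 1] by (simp_all add: \<kappa>'_def algebra_simps)
  have D: "D \<longlonglongrightarrow> (\<kappa>' 0 + 0) * (\<kappa>' 2 + 0) - \<kappa>' 1 * \<kappa>' 1"
    unfolding D_def by (intro tendsto_intros \<kappa>01 \<epsilon> \<delta>)
  then have D: "D \<longlonglongrightarrow> D'" by (simp add: D'_def)
  have Dnz: "\<forall>\<^sub>F n in sequentially. D n \<noteq> 0"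
    using D D'0 by (rule tendsto_imp_eventually_ne)
  have AB: "\<forall>\<^sub>F n in sequentially. A n = (\<kappa> 1 1 n + \<delta> n - \<kappa> 0 1 n) / D n \<and>
      B n = (\<kappa> 0 0 n + \<epsilon> n - \<kappa> 0 1 n) / D n"
    using z[of 0] z[of 1] nz[of 0] nz[of 1] Dnz eventually_gt_at_top[of 0]
  proof eventually_elim
    case (elim n)
    have "\<epsilon> n * A n = y 0 n / r 0 n" "\<delta> n * B n = y 1 n / r 1 n"
      using elim MN by (simp_all add: \<epsilon>_def \<delta>_def A_def B_def T_def)
    moreover have "\<kappa> 1 0 n = \<kappa> 0 1 n" by (simp add: \<kappa>_def K_def T_def mult.commute)
    ultimately have eqs: "(\<kappa> 0 0 n + \<epsilon> n) * A n + \<kappa> 0 1 n * B n = 1"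
        "\<kappa> 0 1 n * A n + (\<kappa> 1 1 n + \<delta> n) * B n = 1"
      using elim by (simp_all add: algebra_simps)
    have "A n * D n = \<kappa> 1 1 n + \<delta> n - \<kappa> 0 1 n" "B n * D n = \<kappa> 0 0 n + \<epsilon> n - \<kappa> 0 1 n"
      unfolding D_def using eqs by algebra+
    then show ?case using elim by (simp add: eq_divide_eq)
  qed
  have "(\<lambda>n. (\<kappa> 1 1 n + \<delta> n - \<kappa> 0 1 n) / D n) \<longlonglongrightarrow> (\<kappa>' 2 + 0 - \<kappa>' 1) / D'"
    by (intro tendsto_intros \<kappa>01 \<delta> D D'0)
  moreover have "(\<kappa>' 2 + 0 - \<kappa>' 1) / D' = - 2 * b * (b + 1)"
    using b unfolding D'_eq by (simp add: \<kappa>'_def divide_simps) algebra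
  ultimately have A: "A \<longlonglongrightarrow> - 2 * b * (b + 1)"
    using AB by (auto elim!: Lim_transform_eventually eventually_mono)
  have "(\<lambda>n. (\<kappa> 0 0 n + \<epsilon> n - \<kappa> 0 1 n) / D n) \<longlonglongrightarrow> (\<kappa>' 0 + 0 - \<kappa>' 1) / D'"
    by (intro tendsto_intros \<kappa>01 \<epsilon> D D'0)
  moreover have "(\<kappa>' 0 + 0 - \<kappa>' 1) / D' = 2 * (b + 1) * (b + 2)"
    using b unfolding D'_eq by (simp add: \<kappa>'_def divide_simps) algebra
  ultimately have B: "B \<longlonglongrightarrow> 2 * (b + 1) * (b + 2)"
    using AB by (auto elim!: Lim_transform_eventually eventually_mono)
  have "(\<lambda>n. 1 - A n * \<kappa> 0 j n - B n * \<kappa> 1 j n) \<longlonglongrightarrow>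
      1 - (- 2 * b * (b + 1)) * (1 / (2 * (b + real 0 + real j)))
        - (2 * (b + 1) * (b + 2)) * (1 / (2 * (b + real 1 + real j)))"
    by (intro tendsto_intros A B \<kappa>)
  moreover have "1 - (- 2 * b * (b + 1)) * (1 / (2 * (b + real 0 + real j)))
        - (2 * (b + 1) * (b + 2)) * (1 / (2 * (b + real 1 + real j)))
      = real j * (real j - 1) / ((b + real j) * (b + real j + 1))"
  proof -
    define x where "x = real j"
    have nz: "b + x \<noteq> 0" "b + x + 1 \<noteq> 0" "b + 1 + x \<noteq> 0" using b by (simp_all add: x_def)
    have "1 - (- 2 * b * (b + 1)) * (1 / (2 * (b + x))) - (2 * (b + 1) * (b + 2)) * (1 / (2 * (b + 1 + x)))
        = 1 + b * (b + 1) / (b + x) - (b + 1) * (b + 2) / (b + x + 1)"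
    proof -
      have "1 - (- 2 * c) * (1 / (2 * p)) - (2 * d) * (1 / (2 * q)) = 1 + c / p - d / q" for c d p q :: real
        by simp
      from this[of "b * (b + 1)" "b + x" "(b + 1) * (b + 2)" "b + 1 + x"]
      show ?thesis by (simp only: mult.assoc add_ac)
    qed
    also have "\<dots> = ((b + x) * (b + x + 1) + b * (b + 1) * (b + x + 1) - (b + 1) * (b + 2) * (b + x))
        / ((b + x) * (b + x + 1))"
      using nz by (simp add: add_divide_distrib diff_divide_distrib)
    also have "(b + x) * (b + x + 1) + b * (b + 1) * (b + x + 1) - (b + 1) * (b + 2) * (b + x) = x * (x - 1)"
      by algebra
    finally show ?thesis by (simp add: x_def)
  qed
  ultimately show ?thesis
    using z[of j] by (auto elim!: Lim_transform_eventually eventually_mono)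
qed

section \<open>Beta integrals and polynomial preliminaries\<close>

lemma Beta_real_pos:
  fixes a b :: real
  assumes "a > 0" "b > 0"
  shows "Beta a b > 0"
  using assms by (simp add: Beta_def Gamma_real_pos)

lemma has_bochner_integral_Beta:
  fixes a b :: real
  assumes "a > 0" "b > 0"
  shows "has_bochner_integral lborel
    (\<lambda>t. indicator {0..1} t * (t powr (a - 1) * (1 - t) powr (b - 1))) (Beta a b)"
proof (rule has_bochner_integral_nn_integral)
  show "0 \<le> Beta a b" using assms by (simp add: Beta_real_pos less_imp_le)
  have "(\<integral>\<^sup>+t. ennreal (t powr (a - 1) * (1 - t) powr (b - 1)) * indicator {0..1} t \<partial>lborel)
      = ennreal (Beta a b)"
    by (rule nn_integral_has_integral_lebesgue'[OF _ has_integral_Beta_real[OF assms]]) simp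
  then show "(\<integral>\<^sup>+t. ennreal (indicator {0..1} t * (t powr (a - 1) * (1 - t) powr (b - 1))) \<partial>lborel)
      = ennreal (Beta a b)"
    by (simp add: ennreal_mult' ennreal_indicator mult.commute)
qed auto

lemma Beta_add_nat_right:
  fixes a b :: real
  assumes "a > 0" "b > 0"
  shows "Beta a (b + real k) = Beta a b * pochhammer b k / pochhammer (a + b) k"
proof (induction k)
  case (Suc k)
  have nn: "b + real k \<notin> \<int>\<^sub>\<le>\<^sub>0" using assms nonpos_Ints_nonpos by fastforce
  have pos: "a + b + real k > 0" "pochhammer (a + b) k > 0" using assms by (auto intro!: pochhammer_pos)
  have "(a + (b + real k)) * Beta a (b + real k + 1) = (b + real k) * Beta a (b + real k)"
    by (rule Beta_plus1_right[OF nn])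
  then have "Beta a (b + real k + 1) = (b + real k) * Beta a (b + real k) / (a + b + real k)"
    using pos by (simp add: eq_divide_eq add_ac mult.commute)
  then show ?case
    using Suc.IH by (simp add: pochhammer_Suc add_ac mult_ac)
qed simp

lemma mult_pochhammer_shift:
  fixes z :: "'a :: comm_semiring_1"
  shows "z * pochhammer (z + 1) k = pochhammer z k * (z + of_nat k)"
  using pochhammer_rec[of z k] pochhammer_Suc[of z k] by simp

lemma pcompose_conv_sum:
  fixes p q :: "real poly"
  assumes "degree p \<le> n"
  shows "pcompose p q = (\<Sum>i\<le>n. smult (coeff p i) (q ^ i))"
proof -
  have "pcompose p q = pcompose (\<Sum>i\<le>n. monom (coeff p i) i) q"
    using assms by (simp add: poly_as_sum_of_monoms')
  also have "\<dots> = (\<Sum>i\<le>n. smult (coeff p i) (q ^ i))"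
    by (simp add: pcompose_sum poly_eq_poly_eq_iff[symmetric] fun_eq_iff poly_sum poly_pcompose poly_monom)
  finally show ?thesis .
qed

lemma poly_higher_pderiv_pcompose_linear:
  fixes p :: "real poly"
  shows "(pderiv ^^ j) (pcompose p [:a, c:]) = smult (c ^ j) (pcompose ((pderiv ^^ j) p) [:a, c:])"
  by (induction j) (simp_all add: pderiv_smult pderiv_pcompose pderiv_pCons mult.commute)

lemma higher_pderiv_diff:
  fixes p q :: "real poly"
  shows "(pderiv ^^ j) (p - q) = (pderiv ^^ j) p - (pderiv ^^ j) q"
  by (induction j) (simp_all add: pderiv_diff)

lemma coeff_pcompose_linear_top:
  fixes p :: "real poly"
  assumes "degree p \<le> n" and "c \<noteq> 0"
  shows "coeff (pcompose p [:a, c:]) n = coeff p n * c ^ n"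
proof (cases "degree p = n")
  case True
  then show ?thesis
    using lead_coeff_comp[of "[:a, c:]" p] degree_pcompose[of p "[:a, c:]"] assms(2) by simp
next
  case False
  with assms show ?thesis by (simp add: coeff_eq_0 degree_pcompose)
qed

text \<open>
  The polynomials \<open>P m\<close> with \<open>m < n\<close> span all polynomials of degree below \<open>n\<close>: subtracting
  a multiple of \<open>P m\<close> removes the leading term. The form need only be linear in its second
  argument, so that the lemma serves the Jacobi and the Sobolev product alike.
\<close>

lemma orthogonal_poly_seq_lower:
  fixes P :: "nat \<Rightarrow> real poly"
  assumes P: "orthogonal_poly_seq ip P"
    and add: "\<And>p q r. ip p (q + r) = ip p q + ip p r"
    and smult: "\<And>p q c. ip p (smult c q) = c * ip p q"
    and q: "\<And>k. k \<ge> n \<Longrightarrow> coeff q k = 0"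
  shows "ip (P n) q = 0"
proof -
  have ip0: "ip p 0 = 0" for p using smult[of p 0 0] by simp
  have "ip (P n) q = 0" if "m \<le> n" "\<And>k. k \<ge> m \<Longrightarrow> coeff q k = 0" for m q
    using that
  proof (induction m arbitrary: q)
    case 0
    then have "q = 0" by (simp add: poly_eq_iff)
    then show ?case by (simp add: ip0)
  next
    case (Suc m)
    have deg: "degree (P m) = m" "coeff (P m) m \<noteq> 0"
      using P leading_coeff_neq_0[of "P m"] by (auto simp: orthogonal_poly_seq_def)
    define c where "c = coeff q m / coeff (P m) m"
    define q' where "q' = q - smult c (P m)"
    have "coeff q' k = 0" if "k \<ge> m" for k
      using that Suc.prems(2)[of k] deg by (cases "k = m") (auto simp: q'_def c_def coeff_eq_0)
    with Suc have "ip (P n) q' = 0" by simp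
    moreover have "ip (P n) (P m) = 0"
      using P Suc.prems(1) by (auto simp: orthogonal_poly_seq_def)
    moreover have "q = q' + smult c (P m)" by (simp add: q'_def)
    ultimately show ?case by (simp add: add smult)
  qed
  from this[OF order_refl q] show ?thesis by simp
qed

section \<open>The Jacobi weight and its hypergeometric orthogonal polynomials\<close>

locale jacobi_weight =
  fixes \<alpha> \<beta> :: real
  assumes \<alpha>: "\<alpha> > -1" and \<beta>: "\<beta> > -1"
begin

definition jint :: "real poly \<Rightarrow> real" where
  "jint p = (\<integral>x. poly p x \<partial>jacobi_measure \<alpha> \<beta>)"

text \<open>
  The substitution \<open>t = (1 + x) / 2\<close> turns the Jacobi weight into the Beta density. The
  closed interval of the Beta integral and the open one of the weight agree pointwise, since
  \<open>0 powr a = 0\<close> by convention.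
\<close>

lemma moment:
  "has_bochner_integral (jacobi_measure \<alpha> \<beta>) (poly ([:1/2, -1/2:] ^ m * [:1/2, 1/2:] ^ k))
     (2 powr (\<alpha> + \<beta> + 1) * Beta (\<alpha> + 1 + real m) (\<beta> + 1 + real k))"
proof -
  define f where "f t = indicator {0..1} t * (t powr (\<beta> + real k) * (1 - t) powr (\<alpha> + real m))" for t :: real
  have f: "has_bochner_integral lborel f (Beta (\<alpha> + 1 + real m) (\<beta> + 1 + real k))"
    using has_bochner_integral_Beta[of "\<beta> + 1 + real k" "\<alpha> + 1 + real m"] \<alpha> \<beta>
    by (simp add: f_def[abs_def] Beta_commute[of "1 + (\<beta> + real k)"] algebra_simps)
  have "has_bochner_integral lborel (\<lambda>x. f (1/2 + 1/2 * x))
      (Beta (\<alpha> + 1 + real m) (\<beta> + 1 + real k) /\<^sub>R \<bar>1/2\<bar>)"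
    using f by (subst (asm) lborel_has_bochner_integral_real_affine_iff[of "1/2" _ _ "1/2"]) simp_all
  then have "has_bochner_integral lborel (\<lambda>x. 2 powr (\<alpha> + \<beta>) * f (1/2 + 1/2 * x))
      (2 powr (\<alpha> + \<beta>) * (Beta (\<alpha> + 1 + real m) (\<beta> + 1 + real k) /\<^sub>R \<bar>1/2\<bar>))"
    by (rule has_bochner_integral_mult_right)
  also have "2 powr (\<alpha> + \<beta>) * (Beta (\<alpha> + 1 + real m) (\<beta> + 1 + real k) /\<^sub>R \<bar>1/2\<bar>)
      = 2 powr (\<alpha> + \<beta> + 1) * Beta (\<alpha> + 1 + real m) (\<beta> + 1 + real k)"
    by (simp add: powr_add)
  also have "(\<lambda>x. 2 powr (\<alpha> + \<beta>) * f (1/2 + 1/2 * x)) =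
     (\<lambda>x. ((1 - x) powr \<alpha> * (1 + x) powr \<beta> * indicator {-1<..<1} x)
        *\<^sub>R poly ([:1/2, -1/2:] ^ m * [:1/2, 1/2:] ^ k) x)"
  proof
    fix x :: real
    show "2 powr (\<alpha> + \<beta>) * f (1/2 + 1/2 * x) = ((1 - x) powr \<alpha> * (1 + x) powr \<beta> * indicator {-1<..<1} x)
        *\<^sub>R poly ([:1/2, -1/2:] ^ m * [:1/2, 1/2:] ^ k) x"
    proof (cases "x \<in> {-1<..<1}")
      case True
      define u t where "u = (1 - x) / 2" and "t = (1 + x) / 2"
      have ut: "u > 0" "t > 0" "1/2 + 1/2 * x = t" "1 - t = u" "1 - x = 2 * u" "1 + x = 2 * t" "t \<le> 1"
        "1/2 - x/2 = u" "1/2 + x/2 = t"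
        using True by (auto simp: u_def t_def field_simps)
      have "2 powr (\<alpha> + \<beta>) * f (1/2 + 1/2 * x) = (2 powr \<alpha> * 2 powr \<beta>) * (t powr \<beta> * t ^ k * (u powr \<alpha> * u ^ m))"
        unfolding f_def ut(3) ut(4) using ut(1,2,7) by (simp add: powr_add powr_realpow)
      also have "\<dots> = ((1 - x) powr \<alpha> * (1 + x) powr \<beta>) * (u ^ m * t ^ k)"
        unfolding ut(5,6) using ut(1,2) by (simp add: powr_mult)
      also have "u ^ m * t ^ k = poly ([:1/2, -1/2:] ^ m * [:1/2, 1/2:] ^ k) x"
        by (simp add: u_def t_def poly_power diff_divide_distrib add_divide_distrib)
      finally show ?thesis using True by simp
    next
      case False
      then have "f (1/2 + 1/2 * x) = 0"
        by (auto simp: f_def indicator_def)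
      with False show ?thesis by simp
    qed
  qed
  finally have "has_bochner_integral (density lborel
        (\<lambda>x. ennreal ((1 - x) powr \<alpha> * (1 + x) powr \<beta> * indicator {-1<..<1} x)))
      (poly ([:1/2, -1/2:] ^ m * [:1/2, 1/2:] ^ k))
      (2 powr (\<alpha> + \<beta> + 1) * Beta (\<alpha> + 1 + real m) (\<beta> + 1 + real k))"
    by (intro has_bochner_integral_density) (auto intro!: borel_measurable_continuous_onI continuous_intros)
  moreover have "ennreal ((1 - x) powr \<alpha> * (1 + x) powr \<beta> * indicator {-1<..<1} x)
      = ennreal ((1 - x) powr \<alpha> * (1 + x) powr \<beta>) * indicator {-1<..<1} x" for x
    by (simp add: indicator_def)
  ultimately show ?thesis by (simp add: jacobi_measure_def)
qed

lemma jint_moment: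
  "jint ([:1/2, -1/2:] ^ m * [:1/2, 1/2:] ^ k)
     = 2 powr (\<alpha> + \<beta> + 1) * Beta (\<alpha> + 1 + real m) (\<beta> + 1 + real k)"
  using moment[of m k] unfolding jint_def by (simp only: has_bochner_integral_iff)

lemma integrable_poly: "integrable (jacobi_measure \<alpha> \<beta>) (poly p)"
proof -
  define g where "g = pcompose p [:-1, 2:]"
  have "p = pcompose g [:1/2, 1/2:]"
    by (simp add: g_def pcompose_assoc[symmetric] pcompose_pCons)
  also have "\<dots> = (\<Sum>i\<le>degree g. smult (coeff g i) ([:1/2, 1/2:] ^ i))"
    by (rule pcompose_conv_sum) simp
  finally have p: "p = (\<Sum>i\<le>degree g. smult (coeff g i) ([:1/2, 1/2:] ^ i))" .
  have "poly p = (\<lambda>x. \<Sum>i\<le>degree g. coeff g i * poly ([:1/2, 1/2:] ^ i) x)"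
    by (subst p) (simp only: fun_eq_iff poly_sum poly_smult simp_thms)
  moreover have "integrable (jacobi_measure \<alpha> \<beta>) (poly ([:1/2, 1/2:] ^ i))" for i
    using moment[of 0 i] by (simp only: has_bochner_integral_iff power_0 mult_1)
  ultimately show ?thesis by (simp only: integrable_mult_right Bochner_Integration.integrable_sum)
qed

lemma jint_add: "jint (p + q) = jint p + jint q"
  by (simp add: jint_def integrable_poly)

lemma jint_smult: "jint (smult c p) = c * jint p"
  by (simp add: jint_def)

lemma jint_diff: "jint (p - q) = jint p - jint q"
  by (simp add: jint_def integrable_poly)

lemma jint_sum: "jint (sum f A) = (\<Sum>i\<in>A. jint (f i))"
proof (induction A rule: infinite_finite_induct)
  case (insert x A)
  then show ?case by (simp add: jint_add)
qed (simp_all add: jint_def)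

lemma jacobi_inner_eq: "jacobi_inner \<alpha> \<beta> p q = jint (p * q)"
  by (simp add: jacobi_inner_def jint_def)

definition hcoeff :: "nat \<Rightarrow> nat \<Rightarrow> real" where
  "hcoeff n k = pochhammer (- real n) k * pochhammer (real n + \<alpha> + \<beta> + 1) k
     / (fact k * pochhammer (\<beta> + 1) k)"

text \<open>
  The hypergeometric polynomial \<open>F(-n, n + \<alpha> + \<beta> + 1; \<beta> + 1; (1 + x) / 2)\<close>: the Jacobi
  polynomial of degree \<open>n\<close> with value \<open>1\<close> at \<open>-1\<close>.
\<close>

definition R :: "nat \<Rightarrow> real poly" where
  "R n = pcompose (\<Sum>k\<le>n. monom (hcoeff n k) k) [:1/2, 1/2:]"

text \<open>
  The integral of \<open>R n\<close> against the \<open>n\<close>-th power of \<open>(1 - x) / 2\<close>.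
\<close>

definition top_moment :: "nat \<Rightarrow> real" where
  "top_moment n = 2 powr (\<alpha> + \<beta> + 1) * Beta (\<alpha> + 1 + real n) (\<beta> + 1) * fact n
     / pochhammer (\<alpha> + \<beta> + 2 + real n) n"

lemma top_moment_pos: "top_moment n > 0"
  using \<alpha> \<beta> by (auto simp: top_moment_def intro!: divide_pos_pos mult_pos_pos pochhammer_pos Beta_real_pos)

lemma degree_hsum: "degree (\<Sum>k\<le>n. monom (hcoeff n k) k) \<le> n"
  by (intro degree_sum_le) (auto intro: order_trans[OF degree_monom_le])

lemma coeff_hsum: "coeff (\<Sum>k\<le>n. monom (hcoeff n k) k) i = (if i \<le> n then hcoeff n i else 0)"
  by (simp add: coeff_sum)

lemma R_eq: "R n = (\<Sum>k\<le>n. smult (hcoeff n k) ([:1/2, 1/2:] ^ k))"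
  unfolding R_def by (subst pcompose_conv_sum[OF degree_hsum]) (simp add: coeff_hsum)

text \<open>
  \<open>R n\<close> is expanded in powers of \<open>(1 + x) / 2\<close> but tested against powers of
  \<open>(1 - x) / 2\<close>. The Beta integral of the mixed product contributes \<open>pochhammer (\<beta> + 1) k\<close>,
  which cancels that factor in the denominator of the coefficient. What is left is a terminating
  Gauss series at \<open>1\<close>, summed by Chu-Vandermonde. The result vanishes for \<open>m < n\<close>.
\<close>

lemma jint_R_mult_power:
  "jint (R n * [:1/2, -1/2:] ^ m)
     = 2 powr (\<alpha> + \<beta> + 1) * Beta (\<alpha> + 1 + real m) (\<beta> + 1)
       * pochhammer (real m + 1 - real n) n / pochhammer (\<alpha> + \<beta> + 2 + real m) n"
proof -
  define C where "C = 2 powr (\<alpha> + \<beta> + 1) * Beta (\<alpha> + 1 + real m) (\<beta> + 1)"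
  define c where "c = \<alpha> + \<beta> + 2 + real m"
  have c: "c > 0" using \<alpha> \<beta> by (simp add: c_def)
  have b: "pochhammer (\<beta> + 1) k > 0" for k using \<beta> by (intro pochhammer_pos) auto
  have "R n * [:1/2, -1/2:] ^ m
      = (\<Sum>k\<le>n. smult (hcoeff n k) ([:1/2, -1/2:] ^ m * [:1/2, 1/2:] ^ k))"
    unfolding R_eq sum_distrib_right
    by (intro sum.cong refl) (simp add: mult.commute)
  then have "jint (R n * [:1/2, -1/2:] ^ m)
      = (\<Sum>k\<le>n. hcoeff n k * (2 powr (\<alpha> + \<beta> + 1) * Beta (\<alpha> + 1 + real m) (\<beta> + 1 + real k)))"
    by (simp only: jint_sum jint_smult jint_moment)
  also have "\<dots> = (\<Sum>k\<le>n. C * (pochhammer (real n + \<alpha> + \<beta> + 1) k * pochhammer (- real n) k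
      / (fact k * pochhammer c k)))"
  proof (rule sum.cong[OF refl])
    fix k
    have "\<alpha> + 1 + real m + (\<beta> + 1) = c" by (simp add: c_def)
    then have "Beta (\<alpha> + 1 + real m) (\<beta> + 1 + real k)
        = Beta (\<alpha> + 1 + real m) (\<beta> + 1) * pochhammer (\<beta> + 1) k / pochhammer c k"
      using Beta_add_nat_right[of "\<alpha> + 1 + real m" "\<beta> + 1" k] \<alpha> \<beta> by simp
    then show "hcoeff n k * (2 powr (\<alpha> + \<beta> + 1) * Beta (\<alpha> + 1 + real m) (\<beta> + 1 + real k))
        = C * (pochhammer (real n + \<alpha> + \<beta> + 1) k * pochhammer (- real n) k / (fact k * pochhammer c k))"
      using b[of k] by (simp add: hcoeff_def C_def)
  qed
  also have "\<dots> = C * (\<Sum>k=0..n. pochhammer (real n + \<alpha> + \<beta> + 1) k * pochhammer (- real n) k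
      / (of_nat (fact k) * pochhammer c k))"
    by (simp add: sum_distrib_left atLeast0AtMost)
  also have "(\<Sum>k=0..n. pochhammer (real n + \<alpha> + \<beta> + 1) k * pochhammer (- real n) k
      / (of_nat (fact k) * pochhammer c k)) = pochhammer (c - (real n + \<alpha> + \<beta> + 1)) n / pochhammer c n"
    by (rule Vandermonde_pochhammer) (use c in \<open>auto simp: add_eq_0_iff[symmetric]\<close>)
  also have "c - (real n + \<alpha> + \<beta> + 1) = real m + 1 - real n" by (simp add: c_def)
  finally show ?thesis by (simp add: C_def c_def)
qed

text \<open>
  Written in powers of \<open>(1 - x) / 2\<close>, only the top power of \<open>p\<close> survives; as
  \<open>x = 1 - 2 * ((1 - x) / 2)\<close>, its coefficient is \<open>(-2) ^ n\<close> times that of \<open>x ^ n\<close>.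
\<close>

lemma jint_R_mult:
  assumes "degree p \<le> n"
  shows "jint (R n * p) = coeff p n * (-2) ^ n * top_moment n"
proof -
  define g where "g = pcompose p [:1, -2:]"
  have "p = pcompose g [:1/2, -1/2:]"
    by (simp add: g_def pcompose_assoc[symmetric] pcompose_pCons)
  also have "degree g \<le> n"
    using degree_pcompose_le[of p "[:1, -2:]"] assms by (simp add: g_def)
  then have "pcompose g [:1/2, -1/2:] = (\<Sum>i\<le>n. smult (coeff g i) ([:1/2, -1/2:] ^ i))"
    by (rule pcompose_conv_sum)
  finally have p: "p = (\<Sum>i\<le>n. smult (coeff g i) ([:1/2, -1/2:] ^ i))" .
  have "jint (R n * p) = (\<Sum>i\<le>n. coeff g i * jint (R n * [:1/2, -1/2:] ^ i))"
    by (subst p) (simp only: sum_distrib_left mult_smult_right jint_sum jint_smult)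
  also have "\<dots> = (\<Sum>i\<le>n. if i = n then coeff g n * top_moment n else 0)"
  proof (rule sum.cong[OF refl])
    fix i assume i: "i \<in> {..n}"
    show "coeff g i * jint (R n * [:1/2, -1/2:] ^ i) = (if i = n then coeff g n * top_moment n else 0)"
    proof (cases "i = n")
      case True
      then show ?thesis unfolding jint_R_mult_power by (simp add: top_moment_def pochhammer_fact)
    next
      case False
      have "\<exists>k<n. real i + 1 - real n = - real k"
        using i False by (intro exI[of _ "n - i - 1"]) (auto simp: of_nat_diff)
      then have "pochhammer (real i + 1 - real n) n = 0" by (simp add: pochhammer_eq_0_iff)
      with False show ?thesis unfolding jint_R_mult_power by simp
    qed
  qed
  also have "\<dots> = coeff p n * (-2) ^ n * top_moment n"
    using coeff_pcompose_linear_top[OF assms, of "-2" 1] by (simp add: g_def)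
  finally show ?thesis .
qed

definition endpoint_deriv :: "nat \<Rightarrow> nat \<Rightarrow> real" where
  "endpoint_deriv j n = poly ((pderiv ^^ j) (R n)) (-1)"

definition inv_sqnorm :: "nat \<Rightarrow> real" where
  "inv_sqnorm n = 1 / jint (R n * R n)"

lemma degree_R_le: "degree (R n) \<le> n"
  using degree_pcompose_le[of "\<Sum>k\<le>n. monom (hcoeff n k) k" "[:1/2, 1/2:]"] degree_hsum[of n]
  by (simp add: R_def)

lemma coeff_R: "coeff (R n) n = hcoeff n n / 2 ^ n"
  unfolding R_def by (subst coeff_pcompose_linear_top[OF degree_hsum]) (simp_all add: coeff_hsum power_divide)

text \<open>
  For \<open>n = 0\<close> the base \<open>\<alpha> + \<beta> + 1\<close> may be negative or zero, but then the product is empty.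
\<close>

lemma pochhammer_numerator_pos: "pochhammer (real n + \<alpha> + \<beta> + 1) n > 0"
  using \<alpha> \<beta> by (cases n) (auto intro!: pochhammer_pos)

lemma hcoeff_same:
  "hcoeff n n = (-1) ^ n * pochhammer (real n + \<alpha> + \<beta> + 1) n / pochhammer (\<beta> + 1) n"
  by (simp add: hcoeff_def pochhammer_same)

lemma pochhammer_denominator_pos: "pochhammer (\<beta> + 1) n > 0"
  using \<beta> by (intro pochhammer_pos) auto

lemma coeff_R_nz: "coeff (R n) n \<noteq> 0"
  using pochhammer_numerator_pos[of n] pochhammer_denominator_pos[of n] by (simp add: coeff_R hcoeff_same)

lemma norm_R:
  "jint (R n * R n) = pochhammer (real n + \<alpha> + \<beta> + 1) n / pochhammer (\<beta> + 1) n * top_moment n"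
proof -
  have "jint (R n * R n) = coeff (R n) n * (-2) ^ n * top_moment n"
    by (rule jint_R_mult[OF degree_R_le])
  also have "coeff (R n) n * (-2) ^ n = pochhammer (real n + \<alpha> + \<beta> + 1) n / pochhammer (\<beta> + 1) n"
  proof -
    have "coeff (R n) n * (-2) ^ n = ((-1) ^ n * (-2) ^ n) / 2 ^ n
        * (pochhammer (real n + \<alpha> + \<beta> + 1) n / pochhammer (\<beta> + 1) n)"
      by (simp add: coeff_R hcoeff_same mult_ac)
    also have "(-1) ^ n * (-2) ^ n = (2 :: real) ^ n"
      by (simp flip: power_mult_distrib)
    finally show ?thesis by simp
  qed
  finally show ?thesis .
qed

lemma norm_R_pos: "jint (R n * R n) > 0"
  using pochhammer_numerator_pos[of n] pochhammer_denominator_pos[of n] top_moment_pos[of n] by (simp add: norm_R)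

lemma endpoint_deriv_eq: "j \<le> n \<Longrightarrow> endpoint_deriv j n = fact j / 2 ^ j * hcoeff n j"
  by (simp add: endpoint_deriv_def R_def poly_higher_pderiv_pcompose_linear poly_pcompose poly_0_coeff_0
      coeff_higher_pderiv coeff_hsum pochhammer_fact power_divide)

section \<open>Growth of endpoint derivatives and norms\<close>

text \<open>
  By lemma \<open>endpoint_deriv_eq\<close> the \<open>n\<close>-dependence is in two Pochhammer symbols, and shifting
  the base of a Pochhammer symbol by one multiplies it by a quotient of linear factors. Each
  of the two contributes \<open>j\<close>.
\<close>

lemma first_order_endpoint_deriv: "first_order (\<lambda>n. endpoint_deriv j (Suc n) / endpoint_deriv j n) (2 * real j)"
proof -
  define \<nu> where "\<nu> = \<alpha> + \<beta> + 1"
  have "first_order (\<lambda>n. ((real n + 1) / (real n + (1 - real j))) * ((real n + (\<nu> + real j)) / (real n + \<nu>)))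
     ((1 - (1 - real j)) + ((\<nu> + real j) - \<nu>))"
    by (intro first_order_mult first_order_linear_quotient)
  moreover have "\<forall>\<^sub>F n in sequentially. ((real n + 1) / (real n + (1 - real j))) * ((real n + (\<nu> + real j)) / (real n + \<nu>))
     = endpoint_deriv j (Suc n) / endpoint_deriv j n"
    using eventually_ge_at_top[of j] eventually_gt_at_top[of 0]
  proof eventually_elim
    case (elim n)
    have pos: "real n + \<nu> > 0" using elim \<alpha> \<beta> by (simp add: \<nu>_def)
    have p1: "pochhammer (- real n) j \<noteq> 0"
      using elim by (auto simp: pochhammer_eq_0_iff)
    have p2: "pochhammer (real n + \<nu>) j > 0" using pos by (rule pochhammer_pos)
    have "pochhammer (- real (Suc n)) j * (real n + (1 - real j)) = (real n + 1) * pochhammer (- real n) j"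
      using mult_pochhammer_shift[of "- real (Suc n)" j] by (simp add: algebra_simps)
    then have "pochhammer (- real (Suc n)) j = (real n + 1) / (real n + (1 - real j)) * pochhammer (- real n) j"
      using elim by (simp add: eq_divide_eq)
    moreover have "pochhammer (real n + \<nu> + 1) j = (real n + (\<nu> + real j)) / (real n + \<nu>) * pochhammer (real n + \<nu>) j"
      using mult_pochhammer_shift[of "real n + \<nu>" j] pos by (simp add: eq_divide_eq algebra_simps)
    moreover have "endpoint_deriv j (Suc n) = fact j / 2 ^ j * (pochhammer (- real (Suc n)) j * pochhammer (real n + \<nu> + 1) j
        / (fact j * pochhammer (\<beta> + 1) j))"
      "endpoint_deriv j n = fact j / 2 ^ j * (pochhammer (- real n) j * pochhammer (real n + \<nu>) j
        / (fact j * pochhammer (\<beta> + 1) j))"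
      using elim by (simp_all add: endpoint_deriv_eq hcoeff_def \<nu>_def add_ac)
    ultimately show ?case
      using p1 p2 pochhammer_denominator_pos[of j] by simp
  qed
  ultimately show ?thesis
    by (simp add: first_order_cong)
qed

text \<open>
  The squared norm is a product of Gamma-type factors. All its shift quotients are linear
  fractions in \<open>n\<close>, three of which remain; their first-order terms \<open>\<alpha> + \<beta>\<close>, \<open>1\<close> and
  \<open>\<beta> - \<alpha>\<close> add up to \<open>2 * \<beta> + 1\<close>.
\<close>

lemma first_order_inv_sqnorm: "first_order (\<lambda>n. inv_sqnorm (Suc n) / inv_sqnorm n) (2 * \<beta> + 1)"
proof -
  define \<nu> where "\<nu> = \<alpha> + \<beta> + 1"
  define C where "C = 2 powr (\<alpha> + \<beta> + 1)"
  define B where "B n = Beta (\<alpha> + 1 + real n) (\<beta> + 1)" for n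
  have C: "C > 0" by (simp add: C_def)
  have Bpos: "B n > 0" for n
    using \<alpha> \<beta> by (simp add: B_def Beta_real_pos)
  \<comment> \<open>For \<open>n > 0\<close> the numerator symbol and the one in \<open>top_moment\<close> have bases
    differing by one, and all but their outer factors cancel.\<close>
  have h: "jint (R n * R n) = C * ((real n + \<nu>) / (2 * real n + \<nu>)) * B n * fact n / pochhammer (\<beta> + 1) n"
    if "n > 0" for n
  proof -
    have pos: "real n + \<nu> > 0" using that \<alpha> \<beta> by (simp add: \<nu>_def)
    have "(real n + \<nu>) * pochhammer (real n + \<nu> + 1) n = pochhammer (real n + \<nu>) n * (2 * real n + \<nu>)"
      using mult_pochhammer_shift[of "real n + \<nu>" n] by (simp add: algebra_simps)
    moreover have "pochhammer (real n + \<nu> + 1) n > 0" using pos by (intro pochhammer_pos) auto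
    ultimately have "pochhammer (real n + \<nu>) n / pochhammer (real n + \<nu> + 1) n = (real n + \<nu>) / (2 * real n + \<nu>)"
      using pos by (simp add: frac_eq_eq)
    moreover have "jint (R n * R n) = C * (pochhammer (real n + \<nu>) n / pochhammer (real n + \<nu> + 1) n)
         * B n * fact n / pochhammer (\<beta> + 1) n"
      by (simp add: norm_R top_moment_def C_def B_def \<nu>_def add_ac mult_ac)
    ultimately show ?thesis by simp
  qed
  have "first_order (\<lambda>n. ((real n + \<nu>) / (real n + 1)) * ((real n + (\<nu> / 2 + 1)) / (real n + \<nu> / 2))
      * ((real n + (\<beta> + 1)) / (real n + (\<alpha> + 1))))
     ((\<nu> - 1) + ((\<nu> / 2 + 1) - \<nu> / 2) + ((\<beta> + 1) - (\<alpha> + 1)))"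
    by (intro first_order_mult first_order_linear_quotient)
  moreover have "\<forall>\<^sub>F n in sequentially. ((real n + \<nu>) / (real n + 1)) * ((real n + (\<nu> / 2 + 1)) / (real n + \<nu> / 2))
      * ((real n + (\<beta> + 1)) / (real n + (\<alpha> + 1))) = inv_sqnorm (Suc n) / inv_sqnorm n"
    using eventually_gt_at_top[of 0]
  proof eventually_elim
    case (elim n)
    have nn: "\<alpha> + 1 + real n \<notin> \<int>\<^sub>\<le>\<^sub>0" using \<alpha> nonpos_Ints_nonpos by fastforce
    have pos: "real n + \<nu> > 0" "real n + \<alpha> + 1 > 0" "real n + \<beta> + 1 > 0" using elim \<alpha> \<beta> by (simp_all add: \<nu>_def)
    have "(real n + \<nu> + 1) * B (Suc n) = (real n + \<alpha> + 1) * B n"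
      using Beta_plus1_left[OF nn, of "\<beta> + 1"] by (simp add: B_def \<nu>_def add_ac)
    then have B: "B (Suc n) = (real n + \<alpha> + 1) * B n / (real n + \<nu> + 1)"
      using pos by (simp add: eq_divide_eq mult.commute)
    have "inv_sqnorm (Suc n) / inv_sqnorm n = jint (R n * R n) / jint (R (Suc n) * R (Suc n))"
      by (simp add: inv_sqnorm_def)
    also have "\<dots> = (C * ((real n + \<nu>) / (2 * real n + \<nu>)) * B n * fact n / pochhammer (\<beta> + 1) n) /
      (C * ((real n + \<nu> + 1) / (2 * (real n + (\<nu> / 2 + 1)))) * ((real n + \<alpha> + 1) * B n / (real n + \<nu> + 1))
        * ((real n + 1) * fact n) / (pochhammer (\<beta> + 1) n * (real n + \<beta> + 1)))"
      using elim by (simp add: h B pochhammer_Suc add_ac distrib_left)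
    also have "2 * real n + \<nu> = 2 * (real n + \<nu> / 2)" by simp
    also have "(C * ((real n + \<nu>) / (2 * (real n + \<nu> / 2))) * B n * fact n / pochhammer (\<beta> + 1) n) /
      (C * ((real n + \<nu> + 1) / (2 * (real n + (\<nu> / 2 + 1)))) * ((real n + \<alpha> + 1) * B n / (real n + \<nu> + 1))
        * ((real n + 1) * fact n) / (pochhammer (\<beta> + 1) n * (real n + \<beta> + 1)))
      = ((real n + \<nu>) / (real n + 1)) * ((real n + (\<nu> / 2 + 1)) / (real n + \<nu> / 2))
      * ((real n + \<beta> + 1) / (real n + \<alpha> + 1))"
    proof -
      have cancel: "(c * (p / (2 * a)) * b * f / q) / (c * (p' / (2 * d)) * (e * b / p') * (g * f) / (q * h))
          = (p / g) * (d / a) * (h / e)"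
        if "c \<noteq> 0" "b \<noteq> 0" "f \<noteq> 0" "q \<noteq> 0" "p' \<noteq> 0" for a b c d e f g h p p' q :: real
        using that by (simp add: mult_ac)
      show ?thesis
        by (rule cancel) (use pos C Bpos[of n] pochhammer_denominator_pos[of n] in auto)
    qed
    finally show ?case by (simp add: add.assoc)
  qed
  moreover have "(\<nu> - 1) + ((\<nu> / 2 + 1) - \<nu> / 2) + ((\<beta> + 1) - (\<alpha> + 1)) = 2 * \<beta> + 1"
    by (simp add: \<nu>_def)
  ultimately show ?thesis
    by (simp only: first_order_cong)
qed

section \<open>Expansions in the hypergeometric basis\<close>

text \<open>
  If \<open>d\<close> had degree \<open>k < n\<close>, its integral against \<open>R k\<close> would be a nonzero multiple of
  its leading coefficient.
\<close>

lemma eq_0_if_orthogonal_R: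
  assumes low: "\<And>k. k \<ge> n \<Longrightarrow> coeff d k = 0" and orth: "\<And>k. k < n \<Longrightarrow> jint (R k * d) = 0"
  shows "d = 0"
proof (rule ccontr)
  assume d: "d \<noteq> 0"
  then have lc: "lead_coeff d \<noteq> 0" by simp
  then have "degree d < n" using low not_le by blast
  from orth[OF this] have "coeff d (degree d) * (-2) ^ degree d * top_moment (degree d) = 0"
    by (simp only: jint_R_mult order_refl)
  with lc top_moment_pos[of "degree d"] show False by simp
qed

lemma jint_R_R: "k \<noteq> m \<Longrightarrow> jint (R k * R m) = 0"
proof (induction k m rule: linorder_wlog)
  case (le k m)
  then have "coeff (R k) m = 0" "degree (R k) \<le> m"
    using degree_R_le[of k] by (auto intro: coeff_eq_0)
  then show ?case by (subst mult.commute) (simp add: jint_R_mult)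
next
  case (sym k m)
  then show ?case by (simp add: mult.commute)
qed

lemma R_expansion:
  assumes "\<And>k. k \<ge> n \<Longrightarrow> coeff d k = 0"
  shows "d = (\<Sum>k<n. smult (jint (R k * d) * inv_sqnorm k) (R k))"
proof -
  define e where "e = (\<Sum>k<n. smult (jint (R k * d) * inv_sqnorm k) (R k))"
  have "d - e = 0"
  proof (rule eq_0_if_orthogonal_R)
    show "coeff (d - e) k = 0" if "k \<ge> n" for k
    proof -
      have "coeff (R i) k = 0" if "i < n" for i
        using that \<open>k \<ge> n\<close> degree_R_le[of i] by (intro coeff_eq_0) auto
      with assms that show ?thesis by (simp add: e_def coeff_sum)
    qed
    show "jint (R k * (d - e)) = 0" if "k < n" for k
    proof -
      have "jint (R k * e) = (\<Sum>i<n. jint (R i * d) * inv_sqnorm i * jint (R k * R i))"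
        by (simp add: e_def sum_distrib_left jint_sum jint_smult)
      also have "\<dots> = (\<Sum>i<n. if i = k then jint (R k * d) else 0)"
        by (intro sum.cong refl) (use norm_R_pos in \<open>auto simp: inv_sqnorm_def jint_R_R less_imp_neq[THEN not_sym]\<close>)
      finally show ?thesis using that by (simp add: right_diff_distrib jint_diff)
    qed
  qed
  then show ?thesis by (simp add: e_def)
qed

lemma monic_jacobi_seq_eq_R:
  assumes "monic_jacobi_seq \<alpha> \<beta> P"
  shows "smult (coeff (R n) n) (P n) = R n"
proof -
  have orth: "orthogonal_poly_seq (jacobi_inner \<alpha> \<beta>) P" and deg: "degree (P n) = n" "coeff (P n) n = 1"
    using assms unfolding monic_jacobi_seq_def orthogonal_poly_seq_def by metis+
  have "smult (coeff (R n) n) (P n) - R n = 0"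
  proof (rule eq_0_if_orthogonal_R)
    show "coeff (smult (coeff (R n) n) (P n) - R n) k = 0" if "k \<ge> n" for k
      using that deg degree_R_le[of n] by (cases "k = n") (auto simp: coeff_eq_0)
    show "jint (R k * (smult (coeff (R n) n) (P n) - R n)) = 0" if "k < n" for k
    proof -
      have "jacobi_inner \<alpha> \<beta> (P n) (R k) = 0"
        using that degree_R_le[of k]
        by (intro orthogonal_poly_seq_lower[OF orth])
           (auto simp: jacobi_inner_eq distrib_left jint_add jint_smult intro!: coeff_eq_0)
      with that show ?thesis
        by (simp add: right_diff_distrib jint_diff jint_smult jint_R_R jacobi_inner_eq mult.commute)
    qed
  qed
  then show ?thesis by simp
qed

text \<open>
  Subtracting the right multiple of \<open>R n\<close> leaves a polynomial of degree below \<open>n\<close>. For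
  \<open>k < n\<close> the Sobolev orthogonality of \<open>Q n\<close> to \<open>R k\<close> expresses their Jacobi product
  through the two point functionals, which gives the coefficients of the expansion.
\<close>

lemma sobolev_expansion:
  assumes Q: "orthogonal_poly_seq (sobolev_inner \<alpha> \<beta> M N) Q"
    and c: "coeff (Q n) n = c * coeff (R n) n"
  shows "Q n = smult c (R n)
    - (\<Sum>k<n. smult ((M * poly (Q n) (-1) * endpoint_deriv 0 k + N * poly (pderiv (Q n)) (-1) * endpoint_deriv 1 k) * inv_sqnorm k) (R k))"
proof -
  have deg: "degree (Q n) = n" using Q by (simp add: orthogonal_poly_seq_def)
  define d where "d = Q n - smult c (R n)"
  have low: "coeff d k = 0" if "k \<ge> n" for k
    using that deg c degree_R_le[of n] by (cases "k = n") (auto simp: d_def coeff_eq_0)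
  have proj: "jint (R k * d) = - (M * poly (Q n) (-1) * endpoint_deriv 0 k + N * poly (pderiv (Q n)) (-1) * endpoint_deriv 1 k)"
    if "k < n" for k
  proof -
    have "sobolev_inner \<alpha> \<beta> M N (Q n) (R k) = 0"
      using that degree_R_le[of k]
      by (intro orthogonal_poly_seq_lower[OF Q])
         (auto simp: sobolev_inner_def jacobi_inner_eq distrib_left jint_add jint_smult
           pderiv_add pderiv_smult algebra_simps intro!: coeff_eq_0)
    then have "jint (R k * Q n) = - (M * poly (Q n) (-1) * endpoint_deriv 0 k + N * poly (pderiv (Q n)) (-1) * endpoint_deriv 1 k)"
      by (simp add: sobolev_inner_def jacobi_inner_eq endpoint_deriv_def mult.commute[of "R k"])
    with that show ?thesis
      by (simp add: d_def right_diff_distrib jint_diff jint_smult jint_R_R)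
  qed
  have "d = (\<Sum>k<n. smult (jint (R k * d) * inv_sqnorm k) (R k))"
    using low by (rule R_expansion)
  also have "\<dots> = - (\<Sum>k<n. smult ((M * poly (Q n) (-1) * endpoint_deriv 0 k + N * poly (pderiv (Q n)) (-1) * endpoint_deriv 1 k) * inv_sqnorm k) (R k))"
    unfolding sum_negf[symmetric] by (intro sum.cong refl) (subst proj, simp_all add: algebra_simps flip: smult_minus_left)
  finally show ?thesis by (simp add: d_def algebra_simps)
qed

end

theorem proposition4p1:
  fixes \<alpha> \<beta> M N :: real and j :: nat and P Q :: "nat \<Rightarrow> real poly"
  assumes "\<alpha> > -1" and "\<beta> > -1" and "M > 0" and "N > 0"
    and "monic_jacobi_seq \<alpha> \<beta> P"
    and "jacobi_sobolev_seq \<alpha> \<beta> M N P Q"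
  shows "(\<lambda>n. poly ((pderiv ^^ j) (Q n)) (-1)
              / poly ((pderiv ^^ j) (jacobi_tilde \<alpha> \<beta> P n)) (-1))
         \<longlonglongrightarrow> real j * (real j - 1) / ((\<beta> + real j + 1) * (\<beta> + real j + 2))"
proof -
  interpret jacobi_weight \<alpha> \<beta> by standard (use assms in auto)
  \<comment> \<open>Both \<open>Q n\<close> and the rescaled Jacobi polynomial have the leading coefficient of
    \<open>smult (c n) (R n)\<close>, so the common factor \<open>c n\<close> cancels in the quotient.\<close>
  define c where "c n = coeff (Q n) n / coeff (R n) n" for n
  define y where "y i n = poly ((pderiv ^^ i) (Q n)) (-1) / c n" for i n
  have Q: "orthogonal_poly_seq (sobolev_inner \<alpha> \<beta> M N) Q"
    and lead: "lead_coeff (Q n) = lead_coeff (jacobi_tilde \<alpha> \<beta> P n)" for n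
    using assms(6) by (auto simp: jacobi_sobolev_seq_def)
  have deg: "degree (Q n) = n" "coeff (Q n) n \<noteq> 0" for n
    using Q leading_coeff_neq_0[of "Q n"] by (auto simp: orthogonal_poly_seq_def)
  have c0: "c n \<noteq> 0" for n using deg coeff_R_nz by (simp add: c_def)
  have tilde: "jacobi_tilde \<alpha> \<beta> P n = smult (c n) (R n)" for n
  proof -
    have P: "degree (P n) = n" "coeff (P n) n = 1"
      using assms(5) unfolding monic_jacobi_seq_def orthogonal_poly_seq_def by metis+
    obtain \<kappa> where \<kappa>: "jacobi_tilde \<alpha> \<beta> P n = smult \<kappa> (P n)" by (simp add: jacobi_tilde_def)
    have "coeff (Q n) n = \<kappa>" using lead[of n] P deg(1)[of n] by (simp add: \<kappa> split: if_splits)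
    then have "smult \<kappa> (P n) = smult (c n) (smult (coeff (R n) n) (P n))"
      using coeff_R_nz by (simp add: c_def)
    then show ?thesis using monic_jacobi_seq_eq_R[OF assms(5)] by (simp add: \<kappa>)
  qed
  have "(\<lambda>n. y j n / endpoint_deriv j n) \<longlonglongrightarrow> real j * (real j - 1) / ((\<beta> + 1 + real j) * (\<beta> + 1 + real j + 1))"
  proof (rule rank_two_perturbation_limit[where S = inv_sqnorm and M = M and N = N])
    show "\<beta> + 1 > 0" "M > 0" "N > 0" using assms by auto
    show "first_order (\<lambda>n. (endpoint_deriv i (Suc n) * endpoint_deriv j (Suc n) * inv_sqnorm (Suc n)) / (endpoint_deriv i n * endpoint_deriv j n * inv_sqnorm n))
        (2 * (\<beta> + 1) + 2 * real i + 2 * real j - 1)" for i j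
      using first_order_mult[OF first_order_mult[OF first_order_endpoint_deriv[of i] first_order_endpoint_deriv[of j]] first_order_inv_sqnorm]
      by (simp add: algebra_simps)
    fix n i
    have "poly ((pderiv ^^ i) (Q n)) (-1) = c n * endpoint_deriv i n
      - (\<Sum>k<n. (M * poly (Q n) (-1) * endpoint_deriv 0 k + N * poly (pderiv (Q n)) (-1) * endpoint_deriv 1 k) * inv_sqnorm k * endpoint_deriv i k)"
      using coeff_R_nz[of n]
      by (subst sobolev_expansion[OF Q, of n "c n"])
         (simp_all add: c_def endpoint_deriv_def higher_pderiv_diff higher_pderiv_smult higher_pderiv_sum poly_sum)
    also have "\<dots> = c n * (endpoint_deriv i n - M * y 0 n * (\<Sum>k<n. endpoint_deriv 0 k * endpoint_deriv i k * inv_sqnorm k)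
        - N * y 1 n * (\<Sum>k<n. endpoint_deriv 1 k * endpoint_deriv i k * inv_sqnorm k))"
      using c0[of n] by (simp add: y_def sum_distrib_left sum.distrib algebra_simps)
    finally show "y i n = endpoint_deriv i n - M * y 0 n * (\<Sum>k<n. endpoint_deriv 0 k * endpoint_deriv i k * inv_sqnorm k)
        - N * y 1 n * (\<Sum>k<n. endpoint_deriv 1 k * endpoint_deriv i k * inv_sqnorm k)"
      using c0[of n] by (simp add: y_def)
  qed
  moreover have "y j n / endpoint_deriv j n = poly ((pderiv ^^ j) (Q n)) (-1)
              / poly ((pderiv ^^ j) (jacobi_tilde \<alpha> \<beta> P n)) (-1)" for n
    by (simp add: tilde y_def endpoint_deriv_def higher_pderiv_smult)
  ultimately show ?thesis by (simp add: add_ac)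
qed

end
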